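(* Let $G$ be a topological group. Then the simplicial spaces $(E_{\mathrm{com}}G)_\bullet$ and $\mathrm{AfCom}_\bullet(G)$ are isomorphic; in particular, $E_{\mathrm{com}}G\cong|\mathrm{AfCom}_\bullet(G)|$.
   Context: $(E_{\mathrm{com}}G)_\bullet$ is the simplicial space with $(E_{\mathrm{com}}G)_n=G\times\mathrm{Hom}(\mathbb{Z}^n,G)\subseteq G^{n+1}$, where $\mathrm{Hom}(\mathbb{Z}^n,G)$ is identified with the subspace of $G^n$ of $n$-tuples of pairwise commuting elements. Its face maps are $d_i(g_0,\dots,g_n)=(g_0,\dots,g_ig_{i+1},\dots,g_n)$ for $i<n$ and $d_n(g_0,\dots,g_n)=(g_0,\dots,g_{n-1})$, and its degeneracies are $s_i(g_0,\dots,g_n)=(g_0,\dots,g_i,e,g_{i+1},\dots,g_n)$. $E_{\mathrm{com}}G$ is its geometric realization. $\mathrm{AfCom}_n(G)\subseteq G^{n+1}$ is the subspace of affinely commutative tuples, i.e. tuples $(g_0,\dots,g_n)$ whose consecutive quotients $g_0^{-1}g_1,\dots,g_{n-1}^{-1}g_n$ pairwise commute; these form a simplicial space $\mathrm{AfCom}_\bullet(G)$ with $d_i(g_0,\dots,g_n)=(g_0,\dots,\widehat{g_i},\dots,g_n)$ and $s_i(g_0,\dots,g_n)=(g_0,\dots,g_i,g_i,\dots,g_n)$. *)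

theory Defs
  imports "HOL-Homology.Homology"
begin

section \<open>Topological groups\<close>

text \<open>No separation axiom is assumed.\<close>

locale topological_group = group G for G :: "('a, 'b) monoid_scheme" (structure) +
  fixes T :: "'a topology"
  assumes topspace_eq_carrier: "topspace T = carrier G"
    and continuous_mult: "continuous_map (prod_topology T T) T (\<lambda>(x, y). x \<otimes> y)"
    and continuous_inv: "continuous_map T T (\<lambda>x. inv x)"


section \<open>Simplicial spaces and their isomorphisms\<close>

text \<open>
  \<open>face X n i\<close> is the face map \<open>d_i\<close> from level \<open>n + 1\<close> to level \<open>n\<close>, for \<open>i \<le> n + 1\<close>, and
  \<open>degen X n i\<close> is the degeneracy \<open>s_i\<close> from level \<open>n\<close> to level \<open>n + 1\<close>, for \<open>i \<le> n\<close>. The first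
  index of both is the smaller of the two levels. Values outside these ranges are irrelevant.
\<close>

record 'a simplicial_data =
  level :: "nat \<Rightarrow> 'a topology"
  face :: "nat \<Rightarrow> nat \<Rightarrow> 'a \<Rightarrow> 'a"
  degen :: "nat \<Rightarrow> nat \<Rightarrow> 'a \<Rightarrow> 'a"

locale simplicial_space =
  fixes X :: "'a simplicial_data"
  assumes continuous_face:
      "i \<le> Suc n \<Longrightarrow> continuous_map (level X (Suc n)) (level X n) (face X n i)"
    and continuous_degen:
      "i \<le> n \<Longrightarrow> continuous_map (level X n) (level X (Suc n)) (degen X n i)"
    and face_face:
      "\<lbrakk>i < j; j \<le> Suc (Suc n); x \<in> topspace (level X (Suc (Suc n)))\<rbrakk>
        \<Longrightarrow> face X n i (face X (Suc n) j x) = face X n (j - 1) (face X (Suc n) i x)"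
    and degen_degen:
      "\<lbrakk>i \<le> j; j \<le> n; x \<in> topspace (level X n)\<rbrakk>
        \<Longrightarrow> degen X (Suc n) i (degen X n j x) = degen X (Suc n) (Suc j) (degen X n i x)"
    and face_degen_less:
      "\<lbrakk>i < j; j \<le> Suc n; x \<in> topspace (level X (Suc n))\<rbrakk>
        \<Longrightarrow> face X (Suc n) i (degen X (Suc n) j x) = degen X n (j - 1) (face X n i x)"
    and face_degen_id:
      "\<lbrakk>j \<le> n; i = j \<or> i = Suc j; x \<in> topspace (level X n)\<rbrakk>
        \<Longrightarrow> face X n i (degen X n j x) = x"
    and face_degen_greater:
      "\<lbrakk>Suc j < i; i \<le> Suc (Suc n); x \<in> topspace (level X (Suc n))\<rbrakk>
        \<Longrightarrow> face X (Suc n) i (degen X (Suc n) j x) = degen X n j (face X n (i - 1) x)"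

definition simplicial_isomorphism ::
    "'a simplicial_data \<Rightarrow> 'b simplicial_data \<Rightarrow> (nat \<Rightarrow> 'a \<Rightarrow> 'b) \<Rightarrow> bool" where
  "simplicial_isomorphism X Y f \<longleftrightarrow>
     (\<forall>n. homeomorphic_map (level X n) (level Y n) (f n)) \<and>
     (\<forall>n. \<forall>i\<le>Suc n. \<forall>x \<in> topspace (level X (Suc n)).
        f n (face X n i x) = face Y n i (f (Suc n) x)) \<and>
     (\<forall>n. \<forall>i\<le>n. \<forall>x \<in> topspace (level X n).
        f (Suc n) (degen X n i x) = degen Y n i (f n x))"

definition isomorphic_simplicial_spaces ::
    "'a simplicial_data \<Rightarrow> 'b simplicial_data \<Rightarrow> bool" where
  "isomorphic_simplicial_spaces X Y \<longleftrightarrow>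
     simplicial_space X \<and> simplicial_space Y \<and> (\<exists>f. simplicial_isomorphism X Y f)"


section \<open>Geometric realization\<close>

definition quotient_topology :: "'a topology \<Rightarrow> ('a \<times> 'a) set \<Rightarrow> 'a set topology" where
  "quotient_topology X r =
     topology (\<lambda>U. U \<subseteq> topspace X // r \<and> openin X {x \<in> topspace X. r `` {x} \<in> U})"

lemma istopology_quotient_topology:
  "istopology (\<lambda>U. U \<subseteq> topspace X // r \<and> openin X {x \<in> topspace X. r `` {x} \<in> U})"
proof -
  have int: "{x \<in> topspace X. r `` {x} \<in> S \<inter> T}
      = {x \<in> topspace X. r `` {x} \<in> S} \<inter> {x \<in> topspace X. r `` {x} \<in> T}" for S T
    by blast
  have un: "{x \<in> topspace X. r `` {x} \<in> \<Union>\<K>}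
      = (\<Union>K\<in>\<K>. {x \<in> topspace X. r `` {x} \<in> K})" for \<K>
    by blast
  show ?thesis
    unfolding istopology_def int un by (blast intro!: openin_Int openin_Union)
qed

lemma openin_quotient_topology:
  "openin (quotient_topology X r) U \<longleftrightarrow>
     U \<subseteq> topspace X // r \<and> openin X {x \<in> topspace X. r `` {x} \<in> U}"
  by (simp add: quotient_topology_def istopology_quotient_topology)

lemma topspace_quotient_topology: "topspace (quotient_topology X r) = topspace X // r"
proof
  show "topspace (quotient_topology X r) \<subseteq> topspace X // r"
    by (metis openin_quotient_topology openin_topspace)
  have "{x \<in> topspace X. r `` {x} \<in> topspace X // r} = topspace X"
    by (auto intro: quotientI)
  then have "openin (quotient_topology X r) (topspace X // r)"
    by (simp add: openin_quotient_topology)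
  then show "topspace X // r \<subseteq> topspace (quotient_topology X r)"
    by (rule openin_subset)
qed

lemma quotient_map_quotient_topology:
  "quotient_map X (quotient_topology X r) (\<lambda>x. r `` {x})"
  by (auto simp: quotient_map_def topspace_quotient_topology openin_quotient_topology
      quotient_def)

abbreviation simplex_topology :: "nat \<Rightarrow> (nat \<Rightarrow> real) topology" where
  "simplex_topology n \<equiv> subtopology (powertop_real UNIV) (standard_simplex n)"

text \<open>
  In barycentric coordinates, the coface \<open>\<delta>^i\<close> of the standard simplices is \<^const>\<open>simplical_face\<close>,
  which inserts a zero in position \<open>i\<close>; the codegeneracy \<open>\<sigma>^i\<close> adds coordinates \<open>i\<close> and \<open>i + 1\<close>.
\<close>

definition simplex_degeneracy :: "nat \<Rightarrow> (nat \<Rightarrow> real) \<Rightarrow> nat \<Rightarrow> real" where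
  "simplex_degeneracy i t =
     (\<lambda>k. if k < i then t k else if k = i then t i + t (Suc i) else t (Suc k))"

definition realization_gluing ::
    "'a simplicial_data \<Rightarrow> ((nat \<times> 'a \<times> (nat \<Rightarrow> real)) \<times> (nat \<times> 'a \<times> (nat \<Rightarrow> real))) set" where
  "realization_gluing X =
     {((n, face X n i x, t), (Suc n, x, simplical_face i t)) | n i x t.
        i \<le> Suc n \<and> x \<in> topspace (level X (Suc n)) \<and> t \<in> standard_simplex n} \<union>
     {((Suc n, degen X n i x, t), (n, x, simplex_degeneracy i t)) | n i x t.
        i \<le> n \<and> x \<in> topspace (level X n) \<and> t \<in> standard_simplex (Suc n)}"

definition geometric_realization ::
    "'a simplicial_data \<Rightarrow> (nat \<times> 'a \<times> (nat \<Rightarrow> real)) set topology" where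
  "geometric_realization X =
     quotient_topology
       (sum_topology (\<lambda>n. prod_topology (level X n) (simplex_topology n)) UNIV)
       ((realization_gluing X \<union> (realization_gluing X)\<inverse>)\<^sup>*)"


section \<open>The two simplicial spaces of a topological group\<close>

text \<open>
  An \<open>n\<close>-tuple is a function on \<open>{..<n}\<close>, extended by \<^const>\<open>undefined\<close>, and a point
  \<open>(g_0, \<dots>, g_n)\<close> of the \<open>(n + 1)\<close>-fold power of \<open>G\<close> is likewise a function on \<open>{..n}\<close>.
  The set \<open>Hom_Z G n\<close> is the space of homomorphisms from the free abelian group of rank \<open>n\<close> to
  \<open>G\<close>, in its identification with commuting tuples.
\<close>

definition Hom_Z :: "('a, 'b) monoid_scheme \<Rightarrow> nat \<Rightarrow> (nat \<Rightarrow> 'a) set" where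
  "Hom_Z G n = {h \<in> {..<n} \<rightarrow>\<^sub>E carrier G. \<forall>i<n. \<forall>j<n. h i \<otimes>\<^bsub>G\<^esub> h j = h j \<otimes>\<^bsub>G\<^esub> h i}"

definition Ecom_level ::
    "('a, 'b) monoid_scheme \<Rightarrow> 'a topology \<Rightarrow> nat \<Rightarrow> (nat \<Rightarrow> 'a) topology" where
  "Ecom_level G T n =
     subtopology (product_topology (\<lambda>_. T) {..n}) {g. (\<lambda>k\<in>{..<n}. g (Suc k)) \<in> Hom_Z G n}"

text \<open>For \<open>i = n + 1\<close> the second case below never occurs, and the face map drops the last entry.\<close>

definition Ecom_face ::
    "('a, 'b) monoid_scheme \<Rightarrow> nat \<Rightarrow> nat \<Rightarrow> (nat \<Rightarrow> 'a) \<Rightarrow> nat \<Rightarrow> 'a" where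
  "Ecom_face G n i g =
     (\<lambda>k\<in>{..n}. if k < i then g k else if k = i then g i \<otimes>\<^bsub>G\<^esub> g (Suc i) else g (Suc k))"

definition Ecom_degen ::
    "('a, 'b) monoid_scheme \<Rightarrow> nat \<Rightarrow> nat \<Rightarrow> (nat \<Rightarrow> 'a) \<Rightarrow> nat \<Rightarrow> 'a" where
  "Ecom_degen G n i g =
     (\<lambda>k\<in>{..Suc n}. if k \<le> i then g k else if k = Suc i then \<one>\<^bsub>G\<^esub> else g (k - 1))"

definition Ecom :: "('a, 'b) monoid_scheme \<Rightarrow> 'a topology \<Rightarrow> (nat \<Rightarrow> 'a) simplicial_data" where
  "Ecom G T = \<lparr>level = Ecom_level G T, face = Ecom_face G, degen = Ecom_degen G\<rparr>"

definition AfCom_level ::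
    "('a, 'b) monoid_scheme \<Rightarrow> 'a topology \<Rightarrow> nat \<Rightarrow> (nat \<Rightarrow> 'a) topology" where
  "AfCom_level G T n =
     subtopology (product_topology (\<lambda>_. T) {..n})
       {g. (\<lambda>k\<in>{..<n}. inv\<^bsub>G\<^esub> (g k) \<otimes>\<^bsub>G\<^esub> g (Suc k)) \<in> Hom_Z G n}"

definition AfCom_face :: "nat \<Rightarrow> nat \<Rightarrow> (nat \<Rightarrow> 'a) \<Rightarrow> nat \<Rightarrow> 'a" where
  "AfCom_face n i g = (\<lambda>k\<in>{..n}. if k < i then g k else g (Suc k))"

definition AfCom_degen :: "nat \<Rightarrow> nat \<Rightarrow> (nat \<Rightarrow> 'a) \<Rightarrow> nat \<Rightarrow> 'a" where
  "AfCom_degen n i g = (\<lambda>k\<in>{..Suc n}. if k \<le> i then g k else g (k - 1))"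

definition AfCom :: "('a, 'b) monoid_scheme \<Rightarrow> 'a topology \<Rightarrow> (nat \<Rightarrow> 'a) simplicial_data" where
  "AfCom G T = \<lparr>level = AfCom_level G T, face = AfCom_face, degen = AfCom_degen\<rparr>"

end

theory Submission
  imports Defs
begin

text \<open>
  The isomorphism sends \<open>(g_0, \<dots>, g_n)\<close> to its partial products
  \<open>(g_0, g_0 g_1, \<dots>, g_0 g_1 \<cdots> g_n)\<close>. The first entry and the consecutive quotients of a tuple
  recover it from its partial products, and both formulas are continuous; since the consecutive
  quotients of the partial products are \<open>g_1, \<dots>, g_n\<close>, the condition that these commute is
  precisely affine commutativity of the image (\<open>homeomorphic_maps_partial_products\<close>). Multiplying
  \<open>g_i\<close> with \<open>g_{i+1}\<close> omits the \<open>i\<close>-th partial product, and inserting the neutral element after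
  position \<open>i\<close> repeats it, so the faces and degeneracies correspond (\<open>partial_products_face\<close>,
  \<open>partial_products_degen\<close>).

  That both sides are simplicial spaces also needs proof. For affinely commutative tuples, the
  faces and degeneracies are reindexings along maps \<open>{0, \<dots>, m} \<rightarrow> {0, \<dots>, n}\<close>. Because commuting of
  consecutive quotients forces all quotients \<open>g_i^{-1} g_j\<close> to commute
  (\<open>affinely_commutative_iff\<close>), every reindexing preserves the condition, and the simplicial
  identities are identities between index maps. They then transfer along the isomorphism
  to \<open>E_com G\<close> (\<open>simplicial_space_transport\<close>).

  The statement about realizations is functoriality: a simplicial map respects the gluing of
  simplices, and mutually inverse simplicial maps induce mutually inverse continuous maps
  (\<open>homeomorphic_realizations\<close>).
\<close>

section \<open>Functoriality of the geometric realization\<close>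

text \<open>
  \<open>C \<mapsto> s `` (F ` C)\<close> is the map induced by \<open>F\<close> on equivalence classes, written without choosing a
  representative; this is how it acts on the class of a given point.
\<close>

lemma quotient_class_image:
  assumes "equiv UNIV r" "equiv UNIV s" and "\<And>x y. (x, y) \<in> r \<Longrightarrow> (F x, F y) \<in> s"
  shows "s `` (F ` (r `` {x})) = s `` {F x}"
proof -
  have "s `` {F y} = s `` {F x}" if "(x, y) \<in> r" for y
    using assms(2,3) that equiv_class_eq by metis
  moreover have "(x, x) \<in> r"
    using assms(1) by (simp add: equiv_def refl_on_def)
  ultimately show ?thesis by blast
qed

lemma continuous_map_quotient_topology:
  assumes F: "continuous_map X Y F"
    and r: "equiv UNIV r" and s: "equiv UNIV s" and rs: "\<And>x y. (x, y) \<in> r \<Longrightarrow> (F x, F y) \<in> s"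
  shows "continuous_map (quotient_topology X r) (quotient_topology Y s) (\<lambda>C. s `` (F ` C))"
proof (rule continuous_compose_quotient_map[OF quotient_map_quotient_topology])
  have "continuous_map X (quotient_topology Y s) ((\<lambda>y. s `` {y}) \<circ> F)"
    using F quotient_imp_continuous_map[OF quotient_map_quotient_topology]
    by (rule continuous_map_compose)
  then show "continuous_map X (quotient_topology Y s) ((\<lambda>C. s `` (F ` C)) \<circ> (\<lambda>x. r `` {x}))"
    by (simp add: o_def quotient_class_image[OF r s rs])
qed

lemma continuous_map_sum_topology_levelwise:
  assumes "\<And>i. continuous_map (X i) (Y i) (f i)"
  shows "continuous_map (sum_topology X UNIV) (sum_topology Y UNIV) (\<lambda>(i, x). (i, f i x))"
proof -
  have "openin (X i) {x. x \<in> topspace (X i) \<and> (i, f i x) \<in> U}"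
    if U: "\<forall>i. openin (Y i) {y. (i, y) \<in> U}" for U i
    using openin_continuous_map_preimage[OF assms, of i "{y. (i, y) \<in> U}"] U by auto
  moreover have "f i x \<in> topspace (Y i)" if "x \<in> topspace (X i)" for i x
    using assms[of i] that by (auto simp: continuous_map_def Pi_def)
  ultimately show ?thesis
    by (auto simp: continuous_map_def openin_sum_topology)
qed

text \<open>
  Unlike \<^const>\<open>simplicial_isomorphism\<close>, this asks for continuity in place of a homeomorphism in each level,
  so that an isomorphism and its inverse are instances of one functorial construction.
\<close>

definition simplicial_map ::
    "'a simplicial_data \<Rightarrow> 'b simplicial_data \<Rightarrow> (nat \<Rightarrow> 'a \<Rightarrow> 'b) \<Rightarrow> bool" where
  "simplicial_map X Y f \<longleftrightarrow>
     (\<forall>n. continuous_map (level X n) (level Y n) (f n)) \<and>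
     (\<forall>n. \<forall>i\<le>Suc n. \<forall>x \<in> topspace (level X (Suc n)).
        f n (face X n i x) = face Y n i (f (Suc n) x)) \<and>
     (\<forall>n. \<forall>i\<le>n. \<forall>x \<in> topspace (level X n).
        f (Suc n) (degen X n i x) = degen Y n i (f n x))"

abbreviation realization_equiv ::
    "'a simplicial_data \<Rightarrow> ((nat \<times> 'a \<times> (nat \<Rightarrow> real)) \<times> (nat \<times> 'a \<times> (nat \<Rightarrow> real))) set" where
  "realization_equiv X \<equiv> (realization_gluing X \<union> (realization_gluing X)\<inverse>)\<^sup>*"

abbreviation simplices_topology :: "'a simplicial_data \<Rightarrow> (nat \<times> 'a \<times> (nat \<Rightarrow> real)) topology" where
  "simplices_topology X \<equiv>
     sum_topology (\<lambda>n. prod_topology (level X n) (simplex_topology n)) UNIV"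

definition simplices_map ::
    "(nat \<Rightarrow> 'a \<Rightarrow> 'b) \<Rightarrow> nat \<times> 'a \<times> (nat \<Rightarrow> real) \<Rightarrow> nat \<times> 'b \<times> (nat \<Rightarrow> real)" where
  "simplices_map f = (\<lambda>(n, x, t). (n, f n x, t))"

definition realization_map ::
    "'b simplicial_data \<Rightarrow> (nat \<Rightarrow> 'a \<Rightarrow> 'b) \<Rightarrow>
       (nat \<times> 'a \<times> (nat \<Rightarrow> real)) set \<Rightarrow> (nat \<times> 'b \<times> (nat \<Rightarrow> real)) set" where
  "realization_map Y f = (\<lambda>C. realization_equiv Y `` (simplices_map f ` C))"

lemma equiv_realization_equiv: "equiv UNIV (realization_equiv X)"
  by (intro equivI refl_rtrancl trans_rtrancl sym_rtrancl) (auto simp: sym_Un_converse)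

text \<open>
  A face map is applied to the point of the simplicial space, the matching coface to the simplex
  coordinate, and a simplicial map changes only the former, with which it commutes; likewise for
  degeneracies.
\<close>

lemma simplices_map_gluing:
  assumes "simplicial_map X Y f" and "(p, q) \<in> realization_gluing X"
  shows "(simplices_map f p, simplices_map f q) \<in> realization_gluing Y"
proof -
  have im: "f n x \<in> topspace (level Y n)" if "x \<in> topspace (level X n)" for n x
    using assms(1) that by (auto simp: simplicial_map_def continuous_map_def Pi_def)
  show ?thesis
    using assms im
    unfolding realization_gluing_def simplices_map_def simplicial_map_def by fastforce
qed

lemma simplices_map_realization_equiv:
  assumes "simplicial_map X Y f" and "(p, q) \<in> realization_equiv X"
  shows "(simplices_map f p, simplices_map f q) \<in> realization_equiv Y"
  using assms(2)
proof induction
  case (step q r)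
  then have "(simplices_map f q, simplices_map f r) \<in> realization_gluing Y \<union> (realization_gluing Y)\<inverse>"
    using simplices_map_gluing[OF assms(1)] by blast
  with step.IH show ?case by (rule rtrancl_into_rtrancl)
qed simp

lemma realization_map_class:
  assumes "simplicial_map X Y f"
  shows "realization_map Y f (realization_equiv X `` {p}) = realization_equiv Y `` {simplices_map f p}"
  unfolding realization_map_def
  using equiv_realization_equiv equiv_realization_equiv simplices_map_realization_equiv[OF assms]
  by (rule quotient_class_image)

lemma continuous_realization_map:
  assumes "simplicial_map X Y f"
  shows "continuous_map (geometric_realization X) (geometric_realization Y) (realization_map Y f)"
proof -
  have "continuous_map (prod_topology (level X n) (simplex_topology n))
          (prod_topology (level Y n) (simplex_topology n)) (\<lambda>(x, t). (f n x, t))" for n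
    using assms by (simp add: simplicial_map_def continuous_map_prod_top[where g = "\<lambda>t. t"])
  then have "continuous_map (simplices_topology X) (simplices_topology Y)
      (\<lambda>(n, z). (n, case z of (x, t) \<Rightarrow> (f n x, t)))"
    by (rule continuous_map_sum_topology_levelwise)
  moreover have "(\<lambda>(n, z). (n, case z of (x, t) \<Rightarrow> (f n x, t))) = simplices_map f"
    by (auto simp: simplices_map_def)
  ultimately have "continuous_map (simplices_topology X) (simplices_topology Y) (simplices_map f)"
    by simp
  then show ?thesis
    unfolding geometric_realization_def realization_map_def
    using equiv_realization_equiv equiv_realization_equiv simplices_map_realization_equiv[OF assms]
    by (rule continuous_map_quotient_topology)
qed

lemma realization_map_inverse:
  assumes f: "simplicial_map X Y f" and g: "simplicial_map Y X g"
    and gf: "\<And>n x. x \<in> topspace (level X n) \<Longrightarrow> g n (f n x) = x"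
    and C: "C \<in> topspace (geometric_realization X)"
  shows "realization_map X g (realization_map Y f C) = C"
proof -
  obtain p where p: "p \<in> topspace (simplices_topology X)" "C = realization_equiv X `` {p}"
    using C by (auto simp: geometric_realization_def topspace_quotient_topology quotient_def)
  then have "simplices_map g (simplices_map f p) = p"
    by (auto simp: simplices_map_def gf)
  with p show ?thesis
    by (simp add: realization_map_class[OF f] realization_map_class[OF g])
qed

text \<open>
  Since \<open>f n\<close> is injective only on the points of the level, the inverse commutes with the structure
  maps because the faces and degeneracies of \<open>X\<close> stay inside the levels of \<open>X\<close>.
\<close>

lemma simplicial_map_inverse:
  assumes X: "simplicial_space X" and f: "simplicial_map X Y f"
    and fg: "\<And>n. homeomorphic_maps (level X n) (level Y n) (f n) (g n)"
  shows "simplicial_map Y X g"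
proof -
  interpret simplicial_space X by fact
  have g: "continuous_map (level Y n) (level X n) (g n)" for n
    using fg by (simp add: homeomorphic_maps_def)
  have gf: "g n (f n x) = x" if "x \<in> topspace (level X n)" for n x
    using fg that by (simp add: homeomorphic_maps_def)
  have fg_id: "f n (g n y) = y" if "y \<in> topspace (level Y n)" for n y
    using fg that by (simp add: homeomorphic_maps_def)
  have g_in: "g n y \<in> topspace (level X n)" if "y \<in> topspace (level Y n)" for n y
    using g that by (auto simp: continuous_map_def Pi_def)
  have "g n (face Y n i y) = face X n i (g (Suc n) y)"
    if i: "i \<le> Suc n" and y: "y \<in> topspace (level Y (Suc n))" for n i y
  proof -
    have "f n (face X n i (g (Suc n) y)) = face Y n i y"
      using f i g_in[OF y] fg_id[OF y] by (simp add: simplicial_map_def)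
    moreover have "face X n i (g (Suc n) y) \<in> topspace (level X n)"
      using continuous_face[OF i] g_in[OF y] by (auto simp: continuous_map_def Pi_def)
    ultimately show ?thesis
      using gf by metis
  qed
  moreover have "g (Suc n) (degen Y n i y) = degen X n i (g n y)"
    if i: "i \<le> n" and y: "y \<in> topspace (level Y n)" for n i y
  proof -
    have "f (Suc n) (degen X n i (g n y)) = degen Y n i y"
      using f i g_in[OF y] fg_id[OF y] by (simp add: simplicial_map_def)
    moreover have "degen X n i (g n y) \<in> topspace (level X (Suc n))"
      using continuous_degen[OF i] g_in[OF y] by (auto simp: continuous_map_def Pi_def)
    ultimately show ?thesis
      using gf by metis
  qed
  ultimately show ?thesis
    using g by (simp add: simplicial_map_def)
qed

theorem homeomorphic_realizations:
  assumes "isomorphic_simplicial_spaces X Y"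
  shows "geometric_realization X homeomorphic_space geometric_realization Y"
proof -
  obtain f where X: "simplicial_space X" and iso: "simplicial_isomorphism X Y f"
    using assms by (auto simp: isomorphic_simplicial_spaces_def)
  then obtain g where fg: "\<And>n. homeomorphic_maps (level X n) (level Y n) (f n) (g n)"
    unfolding simplicial_isomorphism_def homeomorphic_map_maps by metis
  have f: "simplicial_map X Y f"
    using iso
    by (simp add: simplicial_isomorphism_def simplicial_map_def homeomorphic_imp_continuous_map)
  have g: "simplicial_map Y X g"
    using X f fg by (rule simplicial_map_inverse)
  have "homeomorphic_maps (geometric_realization X) (geometric_realization Y)
      (realization_map Y f) (realization_map X g)"
    using fg continuous_realization_map[OF f] continuous_realization_map[OF g]
      realization_map_inverse[OF f g] realization_map_inverse[OF g f]
    by (simp add: homeomorphic_maps_def)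
  then show ?thesis
    by (auto simp: homeomorphic_space_def)
qed


section \<open>Transport of simplicial structure\<close>

text \<open>
  Both sides of each simplicial identity in \<open>X\<close> have the same image under the injection \<open>f\<close>, by the
  identity in \<open>Y\<close>; and a structure map of \<open>X\<close> is continuous as the conjugate of one of \<open>Y\<close>.
\<close>

lemma simplicial_space_transport:
  assumes Y: "simplicial_space Y"
    and fg: "\<And>n. homeomorphic_maps (level X n) (level Y n) (f n) (g n)"
    and face_in: "\<And>n i x. \<lbrakk>i \<le> Suc n; x \<in> topspace (level X (Suc n))\<rbrakk>
          \<Longrightarrow> face X n i x \<in> topspace (level X n)"
    and degen_in: "\<And>n i x. \<lbrakk>i \<le> n; x \<in> topspace (level X n)\<rbrakk>
          \<Longrightarrow> degen X n i x \<in> topspace (level X (Suc n))"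
    and f_face: "\<And>n i x. \<lbrakk>i \<le> Suc n; x \<in> topspace (level X (Suc n))\<rbrakk>
          \<Longrightarrow> f n (face X n i x) = face Y n i (f (Suc n) x)"
    and f_degen: "\<And>n i x. \<lbrakk>i \<le> n; x \<in> topspace (level X n)\<rbrakk>
          \<Longrightarrow> f (Suc n) (degen X n i x) = degen Y n i (f n x)"
  shows "simplicial_space X"
proof -
  interpret Y: simplicial_space Y by fact
  have f: "continuous_map (level X n) (level Y n) (f n)"
    and g: "continuous_map (level Y n) (level X n) (g n)" for n
    using fg by (simp_all add: homeomorphic_maps_def)
  have gf: "g n (f n x) = x" if "x \<in> topspace (level X n)" for n x
    using fg that by (simp add: homeomorphic_maps_def)
  have f_in: "f n x \<in> topspace (level Y n)" if "x \<in> topspace (level X n)" for n x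
    using f that by (auto simp: continuous_map_def Pi_def)
  have eqI: "x = y" if "f n x = f n y" "x \<in> topspace (level X n)" "y \<in> topspace (level X n)" for n x y
    using that gf by metis
  show ?thesis
  proof
    show "continuous_map (level X (Suc n)) (level X n) (face X n i)" if "i \<le> Suc n" for n i
    proof (rule continuous_map_eq)
      show "continuous_map (level X (Suc n)) (level X n) (g n \<circ> (face Y n i \<circ> f (Suc n)))"
        using that f g Y.continuous_face by (blast intro: continuous_map_compose)
    qed (use that face_in gf in \<open>simp flip: f_face\<close>)
    show "continuous_map (level X n) (level X (Suc n)) (degen X n i)" if "i \<le> n" for n i
    proof (rule continuous_map_eq)
      show "continuous_map (level X n) (level X (Suc n)) (g (Suc n) \<circ> (degen Y n i \<circ> f n))"
        using that f g Y.continuous_degen by (blast intro: continuous_map_compose)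
    qed (use that degen_in gf in \<open>simp flip: f_degen\<close>)
  next
    fix i j n x
    assume "i < j" "j \<le> Suc (Suc n)" "x \<in> topspace (level X (Suc (Suc n)))"
    then show "face X n i (face X (Suc n) j x) = face X n (j - 1) (face X (Suc n) i x)"
      by (intro eqI[of n]) (auto simp: f_face face_in f_in Y.face_face)
  next
    fix i j n x
    assume "i \<le> j" "j \<le> n" "x \<in> topspace (level X n)"
    then show "degen X (Suc n) i (degen X n j x) = degen X (Suc n) (Suc j) (degen X n i x)"
      by (intro eqI[of "Suc (Suc n)"]) (auto simp: f_degen degen_in f_in Y.degen_degen)
  next
    fix i j n x
    assume "i < j" "j \<le> Suc n" "x \<in> topspace (level X (Suc n))"
    then show "face X (Suc n) i (degen X (Suc n) j x) = degen X n (j - 1) (face X n i x)"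
      by (intro eqI[of "Suc n"]) (auto simp: f_face f_degen face_in degen_in f_in Y.face_degen_less)
  next
    fix i j n x
    assume "j \<le> n" "i = j \<or> i = Suc j" "x \<in> topspace (level X n)"
    then show "face X n i (degen X n j x) = x"
      by (intro eqI[of n]) (auto simp: f_face f_degen face_in degen_in f_in Y.face_degen_id)
  next
    fix i j n x
    assume "Suc j < i" "i \<le> Suc (Suc n)" "x \<in> topspace (level X (Suc n))"
    then show "face X (Suc n) i (degen X (Suc n) j x) = degen X n j (face X n (i - 1) x)"
      by (intro eqI[of "Suc n"])
        (auto simp: f_face f_degen face_in degen_in f_in Y.face_degen_greater)
  qed
qed


section \<open>Affinely commutative tuples\<close>

context group
begin

lemma commutes_inv:
  assumes "x \<in> carrier G" "y \<in> carrier G" "x \<otimes> y = y \<otimes> x"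
  shows "x \<otimes> inv y = inv y \<otimes> x"
proof -
  have "inv y \<otimes> x = inv y \<otimes> (x \<otimes> y) \<otimes> inv y"
    using assms(1,2) by (simp add: m_assoc)
  also have "\<dots> = x \<otimes> inv y"
    unfolding assms(3) using assms(1,2) by (simp flip: m_assoc)
  finally show ?thesis by simp
qed

lemma commutes_mult:
  assumes "x \<in> carrier G" "y \<in> carrier G" "z \<in> carrier G"
    and "x \<otimes> y = y \<otimes> x" "x \<otimes> z = z \<otimes> x"
  shows "x \<otimes> (y \<otimes> z) = (y \<otimes> z) \<otimes> x"
proof -
  have "x \<otimes> (y \<otimes> z) = y \<otimes> (x \<otimes> z)"
    using assms(1-4) by (simp flip: m_assoc)
  then show ?thesis
    using assms(1-3,5) by (simp add: m_assoc)
qed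

lemma quotient_mult_quotient:
  assumes "a \<in> carrier G" "b \<in> carrier G" "c \<in> carrier G"
  shows "(inv a \<otimes> b) \<otimes> (inv b \<otimes> c) = inv a \<otimes> c"
proof -
  have "b \<otimes> (inv b \<otimes> c) = c"
    using assms by (simp flip: m_assoc)
  with assms show ?thesis by (simp add: m_assoc)
qed

text \<open>
  The elements commuting with \<open>x\<close> form a subgroup, and \<open>g_i^{-1} g_j\<close> is a product of consecutive
  quotients and their inverses.
\<close>

lemma commutes_quotients:
  assumes x: "x \<in> carrier G" and g: "\<And>k. k \<le> n \<Longrightarrow> g k \<in> carrier G"
    and comm: "\<And>k. k < n \<Longrightarrow> x \<otimes> (inv (g k) \<otimes> g (Suc k)) = (inv (g k) \<otimes> g (Suc k)) \<otimes> x"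
    and "i \<le> n" "j \<le> n"
  shows "x \<otimes> (inv (g i) \<otimes> g j) = (inv (g i) \<otimes> g j) \<otimes> x"
proof -
  \<comment> \<open>\<open>g_0^{-1} g_k\<close> telescopes into consecutive quotients without inverses; an arbitrary
    \<open>g_i^{-1} g_j\<close> is then the quotient of two such elements.\<close>
  have zero: "x \<otimes> (inv (g 0) \<otimes> g k) = (inv (g 0) \<otimes> g k) \<otimes> x" if "k \<le> n" for k
    using that
  proof (induction k)
    case 0
    then show ?case using x g by simp
  next
    case (Suc k)
    have "inv (g 0) \<otimes> g (Suc k) = (inv (g 0) \<otimes> g k) \<otimes> (inv (g k) \<otimes> g (Suc k))"
      using Suc.prems g by (simp add: quotient_mult_quotient)
    with Suc show ?case
      using x g comm[of k] commutes_mult[of x "inv (g 0) \<otimes> g k" "inv (g k) \<otimes> g (Suc k)"] by simp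
  qed
  have closed: "inv (g 0) \<otimes> g k \<in> carrier G" if "k \<le> n" for k
    using g that by simp
  have eq: "inv (g i) \<otimes> g j = inv (inv (g 0) \<otimes> g i) \<otimes> (inv (g 0) \<otimes> g j)"
    using assms g by (simp add: inv_mult_group quotient_mult_quotient)
  show ?thesis
    unfolding eq
    by (intro commutes_mult commutes_inv zero x closed inv_closed \<open>i \<le> n\<close> \<open>j \<le> n\<close>)
qed

text \<open>
  Quantifying over all quotients, not just the consecutive ones, makes the condition visibly
  stable under omitting, repeating and permuting entries.
\<close>

definition affinely_commutative :: "nat \<Rightarrow> (nat \<Rightarrow> 'a) \<Rightarrow> bool" where
  "affinely_commutative n g \<longleftrightarrow> (\<forall>i\<le>n. \<forall>j\<le>n. \<forall>k\<le>n. \<forall>l\<le>n.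
     (inv (g i) \<otimes> g j) \<otimes> (inv (g k) \<otimes> g l) = (inv (g k) \<otimes> g l) \<otimes> (inv (g i) \<otimes> g j))"

text \<open>
  The centralizer argument of \<open>commutes_quotients\<close> is applied twice: to a consecutive quotient \<open>x\<close>,
  and then to an arbitrary one.
\<close>

lemma affinely_commutative_iff:
  assumes g: "\<And>k. k \<le> n \<Longrightarrow> g k \<in> carrier G"
  shows "affinely_commutative n g \<longleftrightarrow> (\<lambda>k\<in>{..<n}. inv (g k) \<otimes> g (Suc k)) \<in> Hom_Z G n"
proof
  assume "affinely_commutative n g"
  then show "(\<lambda>k\<in>{..<n}. inv (g k) \<otimes> g (Suc k)) \<in> Hom_Z G n"
    using g by (auto simp: affinely_commutative_def Hom_Z_def)
next
  assume "(\<lambda>k\<in>{..<n}. inv (g k) \<otimes> g (Suc k)) \<in> Hom_Z G n"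
  then have *: "(inv (g i) \<otimes> g (Suc i)) \<otimes> (inv (g k) \<otimes> g (Suc k))
      = (inv (g k) \<otimes> g (Suc k)) \<otimes> (inv (g i) \<otimes> g (Suc i))" if "i < n" "k < n" for i k
    using that by (simp add: Hom_Z_def)
  have **: "(inv (g i) \<otimes> g (Suc i)) \<otimes> (inv (g k) \<otimes> g l)
      = (inv (g k) \<otimes> g l) \<otimes> (inv (g i) \<otimes> g (Suc i))" if "i < n" "k \<le> n" "l \<le> n" for i k l
  proof (rule commutes_quotients[where n = n])
    show "inv (g i) \<otimes> g (Suc i) \<in> carrier G"
      using that(1) g by simp
  qed (use that g * in blast)+
  show "affinely_commutative n g"
    unfolding affinely_commutative_def
  proof (intro allI impI)
    fix i j k l assume ij: "i \<le> n" "j \<le> n" and kl: "k \<le> n" "l \<le> n"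
    show "(inv (g i) \<otimes> g j) \<otimes> (inv (g k) \<otimes> g l) = (inv (g k) \<otimes> g l) \<otimes> (inv (g i) \<otimes> g j)"
    proof (rule commutes_quotients[where n = n and g = g and i = k and j = l])
      show "inv (g i) \<otimes> g j \<in> carrier G"
        using ij g by simp
    qed (use ij kl g **[symmetric] in blast)+
  qed
qed

end

context topological_group
begin

lemma topspace_AfCom_level:
  "topspace (AfCom_level G T n) = {g \<in> {..n} \<rightarrow>\<^sub>E carrier G. affinely_commutative n g}"
proof -
  have "affinely_commutative n g \<longleftrightarrow> (\<lambda>k\<in>{..<n}. inv (g k) \<otimes> g (Suc k)) \<in> Hom_Z G n"
    if "g \<in> {..n} \<rightarrow>\<^sub>E carrier G" for g
    using that by (intro affinely_commutative_iff) auto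
  then show ?thesis
    by (auto simp: AfCom_level_def topspace_eq_carrier)
qed

text \<open>
  The faces and degeneracies are instances, for \<open>\<phi>\<close> omitting or repeating one index.
\<close>

lemma continuous_map_AfCom_reindex:
  assumes \<phi>: "\<And>k. k \<le> m \<Longrightarrow> \<phi> k \<le> n"
  shows "continuous_map (AfCom_level G T n) (AfCom_level G T m) (\<lambda>g. \<lambda>k\<in>{..m}. g (\<phi> k))"
proof -
  have "continuous_map (AfCom_level G T n) T (\<lambda>g. g (\<phi> k))" if "k \<le> m" for k
    unfolding AfCom_level_def using \<phi> that
    by (intro continuous_map_from_subtopology continuous_map_product_projection) auto
  then have "continuous_map (AfCom_level G T n) (product_topology (\<lambda>_. T) {..m})
      (\<lambda>g. \<lambda>k\<in>{..m}. g (\<phi> k))"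
    by (auto simp: continuous_map_componentwise)
  moreover have "(\<lambda>k\<in>{..m}. g (\<phi> k)) \<in> topspace (AfCom_level G T m)"
    if "g \<in> topspace (AfCom_level G T n)" for g
    using that \<phi> by (auto simp: topspace_AfCom_level affinely_commutative_def)
  ultimately show ?thesis
    by (auto simp: AfCom_level_def[of G T m] continuous_map_in_subtopology)
qed

lemma simplicial_space_AfCom: "simplicial_space (AfCom G T)"
proof
  show "continuous_map (level (AfCom G T) (Suc n)) (level (AfCom G T) n) (face (AfCom G T) n i)"
    if "i \<le> Suc n" for n i
  proof -
    have "face (AfCom G T) n i = (\<lambda>g. \<lambda>k\<in>{..n}. g (if k < i then k else Suc k))"
      by (auto simp: AfCom_def AfCom_face_def fun_eq_iff)
    then show ?thesis
      by (simp only: AfCom_def simplicial_data.simps) (rule continuous_map_AfCom_reindex, auto)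
  qed
  show "continuous_map (level (AfCom G T) n) (level (AfCom G T) (Suc n)) (degen (AfCom G T) n i)"
    if "i \<le> n" for n i
  proof -
    have "degen (AfCom G T) n i = (\<lambda>g. \<lambda>k\<in>{..Suc n}. g (if k \<le> i then k else k - 1))"
      by (auto simp: AfCom_def AfCom_degen_def fun_eq_iff)
    then show ?thesis
      using that
      by (simp only: AfCom_def simplicial_data.simps) (rule continuous_map_AfCom_reindex, auto)
  qed
next
  fix i j n :: nat and x :: "nat \<Rightarrow> 'a"
  assume "i < j" "j \<le> Suc (Suc n)"
  then show "face (AfCom G T) n i (face (AfCom G T) (Suc n) j x)
      = face (AfCom G T) n (j - 1) (face (AfCom G T) (Suc n) i x)"
    by (auto simp: AfCom_def AfCom_face_def fun_eq_iff)
next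
  fix i j n :: nat and x :: "nat \<Rightarrow> 'a"
  assume "i \<le> j" "j \<le> n"
  then show "degen (AfCom G T) (Suc n) i (degen (AfCom G T) n j x)
      = degen (AfCom G T) (Suc n) (Suc j) (degen (AfCom G T) n i x)"
    by (auto simp: AfCom_def AfCom_degen_def fun_eq_iff)
next
  fix i j n :: nat and x :: "nat \<Rightarrow> 'a"
  assume "i < j" "j \<le> Suc n"
  then show "face (AfCom G T) (Suc n) i (degen (AfCom G T) (Suc n) j x)
      = degen (AfCom G T) n (j - 1) (face (AfCom G T) n i x)"
    by (auto simp: AfCom_def AfCom_face_def AfCom_degen_def fun_eq_iff)
next
  fix i j n :: nat and x
  assume "j \<le> n" "i = j \<or> i = Suc j" "x \<in> topspace (level (AfCom G T) n)"
  then show "face (AfCom G T) n i (degen (AfCom G T) n j x) = x"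
    by (auto simp: AfCom_def AfCom_face_def AfCom_degen_def AfCom_level_def fun_eq_iff
        PiE_iff extensional_def)
next
  fix i j n :: nat and x :: "nat \<Rightarrow> 'a"
  assume "Suc j < i" "i \<le> Suc (Suc n)"
  then show "face (AfCom G T) (Suc n) i (degen (AfCom G T) (Suc n) j x)
      = degen (AfCom G T) n j (face (AfCom G T) n (i - 1) x)"
    by (auto simp: AfCom_def AfCom_face_def AfCom_degen_def fun_eq_iff)
qed


section \<open>Partial products\<close>

primrec partial_product :: "(nat \<Rightarrow> 'a) \<Rightarrow> nat \<Rightarrow> 'a" where
  "partial_product g 0 = g 0"
| "partial_product g (Suc k) = partial_product g k \<otimes> g (Suc k)"

definition partial_products :: "nat \<Rightarrow> (nat \<Rightarrow> 'a) \<Rightarrow> nat \<Rightarrow> 'a" where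
  "partial_products n g = (\<lambda>k\<in>{..n}. partial_product g k)"

definition consecutive_quotients :: "nat \<Rightarrow> (nat \<Rightarrow> 'a) \<Rightarrow> nat \<Rightarrow> 'a" where
  "consecutive_quotients n h = (\<lambda>k\<in>{..n}. if k = 0 then h 0 else inv (h (k - 1)) \<otimes> h k)"

lemma partial_product_closed:
  assumes "g \<in> {..n} \<rightarrow>\<^sub>E carrier G" "k \<le> n"
  shows "partial_product g k \<in> carrier G"
  using assms(2) by (induction k) (use assms(1) in auto)

lemma consecutive_quotients_partial_products:
  assumes g: "g \<in> {..n} \<rightarrow>\<^sub>E carrier G"
  shows "consecutive_quotients n (partial_products n g) = g"
proof (rule PiE_ext[OF _ g])
  show step: "consecutive_quotients n (partial_products n g) k = g k" if "k \<in> {..n}" for k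
  proof (cases k)
    case (Suc j)
    then have "partial_product g j \<in> carrier G" "g k \<in> carrier G"
      using g that partial_product_closed by auto
    then show ?thesis
      using that Suc
      by (simp add: consecutive_quotients_def partial_products_def flip: m_assoc)
  qed (simp add: consecutive_quotients_def partial_products_def)
  then show "consecutive_quotients n (partial_products n g) \<in> {..n} \<rightarrow>\<^sub>E carrier G"
    using g by (auto simp: PiE_iff) (simp add: consecutive_quotients_def)
qed

lemma partial_products_consecutive_quotients:
  assumes h: "h \<in> {..n} \<rightarrow>\<^sub>E carrier G"
  shows "partial_products n (consecutive_quotients n h) = h"
proof -
  have "partial_product (consecutive_quotients n h) k = h k" if "k \<le> n" for k
    using that
  proof (induction k)
    case (Suc k)
    then have "h k \<in> carrier G" "h (Suc k) \<in> carrier G"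
      using h by auto
    with Suc show ?case
      by (simp add: consecutive_quotients_def flip: m_assoc)
  qed (simp add: consecutive_quotients_def)
  then show ?thesis
    using h by (auto simp: partial_products_def fun_eq_iff PiE_iff extensional_def)
qed

lemma topspace_Ecom_level:
  "topspace (Ecom_level G T n) =
     {g \<in> {..n} \<rightarrow>\<^sub>E carrier G. (\<lambda>k\<in>{..<n}. g (Suc k)) \<in> Hom_Z G n}"
  by (auto simp: Ecom_level_def topspace_eq_carrier)

text \<open>
  The consecutive quotients of the partial products of \<open>g\<close> are \<open>g_1, \<dots>, g_n\<close>, so both memberships
  impose the same commutation relations.
\<close>

lemma mem_Ecom_level_iff:
  assumes g: "g \<in> {..n} \<rightarrow>\<^sub>E carrier G"
  shows "g \<in> topspace (Ecom_level G T n) \<longleftrightarrow> partial_products n g \<in> topspace (AfCom_level G T n)"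
proof -
  have "inv (partial_products n g k) \<otimes> partial_products n g (Suc k) = g (Suc k)" if "k < n" for k
    using fun_cong[OF consecutive_quotients_partial_products[OF g], of "Suc k"] that
    by (simp add: consecutive_quotients_def)
  then have "(\<lambda>k\<in>{..<n}. inv (partial_products n g k) \<otimes> partial_products n g (Suc k))
      = (\<lambda>k\<in>{..<n}. g (Suc k))"
    by auto
  moreover have "partial_products n g \<in> {..n} \<rightarrow>\<^sub>E carrier G"
    using partial_product_closed[OF g] by (simp add: partial_products_def)
  ultimately show ?thesis
    using g by (simp add: topspace_Ecom_level AfCom_level_def topspace_eq_carrier)
qed

lemma continuous_map_mult:
  assumes "continuous_map X T f" "continuous_map X T g"
  shows "continuous_map X T (\<lambda>x. f x \<otimes> g x)"
  using continuous_map_compose[OF continuous_map_pairedI[OF assms] continuous_mult]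
  by (simp add: o_def)

lemma homeomorphic_maps_partial_products:
  "homeomorphic_maps (Ecom_level G T n) (AfCom_level G T n)
     (partial_products n) (consecutive_quotients n)"
proof -
  have E: "continuous_map (Ecom_level G T n) T (\<lambda>g. g k)"
    and A: "continuous_map (AfCom_level G T n) T (\<lambda>g. g k)" if "k \<le> n" for k
    unfolding Ecom_level_def AfCom_level_def using that
    by (auto intro!: continuous_map_from_subtopology continuous_map_product_projection)
  have in_E: "g \<in> {..n} \<rightarrow>\<^sub>E carrier G" if "g \<in> topspace (Ecom_level G T n)" for g
    using that by (simp add: topspace_Ecom_level)
  have in_A: "h \<in> {..n} \<rightarrow>\<^sub>E carrier G" if "h \<in> topspace (AfCom_level G T n)" for h
    using that by (simp add: topspace_AfCom_level)
  have "continuous_map (Ecom_level G T n) T (\<lambda>g. partial_product g k)" if "k \<le> n" for k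
    using that by (induction k) (simp_all add: E continuous_map_mult)
  then have "continuous_map (Ecom_level G T n) (product_topology (\<lambda>_. T) {..n}) (partial_products n)"
    by (auto simp: continuous_map_componentwise partial_products_def)
  moreover have "partial_products n g \<in> topspace (AfCom_level G T n)"
    if "g \<in> topspace (Ecom_level G T n)" for g
    using mem_Ecom_level_iff that in_E by blast
  ultimately have f: "continuous_map (Ecom_level G T n) (AfCom_level G T n) (partial_products n)"
    by (auto simp: AfCom_level_def[of G T n] continuous_map_in_subtopology)
  have "continuous_map (AfCom_level G T n) T
      (\<lambda>h. if k = 0 then h 0 else inv (h (k - 1)) \<otimes> h k)" if "k \<le> n" for k
  proof (cases k)
    case (Suc j)
    then have "continuous_map (AfCom_level G T n) T (\<lambda>h. inv (h j))"
      using that continuous_map_compose[OF A[of j] continuous_inv] by (simp add: o_def)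
    with Suc that show ?thesis
      by (simp add: A continuous_map_mult)
  qed (simp add: A)
  then have c: "continuous_map (AfCom_level G T n) (product_topology (\<lambda>_. T) {..n})
      (consecutive_quotients n)"
    by (auto simp: continuous_map_componentwise consecutive_quotients_def)
  moreover have "consecutive_quotients n h \<in> topspace (Ecom_level G T n)"
    if "h \<in> topspace (AfCom_level G T n)" for h
  proof -
    have "consecutive_quotients n h \<in> {..n} \<rightarrow>\<^sub>E carrier G"
      using in_A[OF that] by (auto simp: consecutive_quotients_def PiE_iff)
    then show ?thesis
      using that mem_Ecom_level_iff partial_products_consecutive_quotients[OF in_A[OF that]] by simp
  qed
  ultimately have "continuous_map (AfCom_level G T n) (Ecom_level G T n) (consecutive_quotients n)"
    by (auto simp: Ecom_level_def[of G T n] continuous_map_in_subtopology)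
  with f show ?thesis
    using in_E in_A
    by (simp add: homeomorphic_maps_def consecutive_quotients_partial_products
        partial_products_consecutive_quotients)
qed

text \<open>
  For \<open>i \<le> n\<close>, the products before position \<open>i\<close> are unchanged, and from there on each one
  contains \<open>g_i g_{i+1}\<close> as a single factor, so it equals the next partial product of \<open>g\<close>. For
  \<open>i = n + 1\<close>, both sides drop the last entry.
\<close>

lemma partial_products_face:
  assumes g: "g \<in> {..Suc n} \<rightarrow>\<^sub>E carrier G"
  shows "partial_products n (Ecom_face G n i g) = AfCom_face n i (partial_products (Suc n) g)"
proof -
  have "partial_product (Ecom_face G n i g) k
      = (if k < i then partial_product g k else partial_product g (Suc k))" if "k \<le> n" for k
    using that
  proof (induction k)
    case (Suc k)
    then have "partial_product g k \<in> carrier G" "g (Suc k) \<in> carrier G" "g (Suc (Suc k)) \<in> carrier G"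
      using g partial_product_closed[OF g] by auto
    with Suc show ?case
      by (cases "Suc k = i") (auto simp: Ecom_face_def m_assoc)
  qed (auto simp: Ecom_face_def)
  then show ?thesis
    by (auto simp: partial_products_def AfCom_face_def fun_eq_iff)
qed

text \<open>
  The inserted neutral element repeats the partial product at position \<open>i\<close> and leaves the later
  ones unchanged up to the shift.
\<close>

lemma partial_products_degen:
  assumes g: "g \<in> {..n} \<rightarrow>\<^sub>E carrier G" and "i \<le> n"
  shows "partial_products (Suc n) (Ecom_degen G n i g) = AfCom_degen n i (partial_products n g)"
proof -
  have "partial_product (Ecom_degen G n i g) k
      = (if k \<le> i then partial_product g k else partial_product g (k - 1))" if "k \<le> Suc n" for k
    using that
  proof (induction k)
    case (Suc k)
    show ?case
    proof (cases "k \<le> i")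
      case True
      then show ?thesis
        using Suc partial_product_closed[OF g, of k] assms(2)
        by (cases "k = i") (auto simp: Ecom_degen_def)
    next
      case False
      then obtain j where "k = Suc j" by (cases k) auto
      with False Suc show ?thesis
        by (auto simp: Ecom_degen_def)
    qed
  qed (auto simp: Ecom_degen_def)
  then show ?thesis
    using assms(2) by (auto simp: partial_products_def AfCom_degen_def fun_eq_iff)
qed

lemma isomorphic_Ecom_AfCom: "isomorphic_simplicial_spaces (Ecom G T) (AfCom G T)"
proof -
  interpret AfCom: simplicial_space "AfCom G T"
    by (rule simplicial_space_AfCom)
  have maps: "homeomorphic_maps (level (Ecom G T) n) (level (AfCom G T) n)
      (partial_products n) (consecutive_quotients n)" for n
    by (simp add: Ecom_def AfCom_def homeomorphic_maps_partial_products)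
  have in_E: "g \<in> {..n} \<rightarrow>\<^sub>E carrier G" if "g \<in> topspace (level (Ecom G T) n)" for g n
    using that by (simp add: Ecom_def topspace_Ecom_level)
  have E_iff: "g \<in> topspace (level (Ecom G T) n) \<longleftrightarrow>
      partial_products n g \<in> topspace (level (AfCom G T) n)" if "g \<in> {..n} \<rightarrow>\<^sub>E carrier G" for g n
    using mem_Ecom_level_iff[OF that] by (simp add: Ecom_def AfCom_def)
  have f_face: "partial_products n (face (Ecom G T) n i g)
      = face (AfCom G T) n i (partial_products (Suc n) g)"
    if "i \<le> Suc n" "g \<in> topspace (level (Ecom G T) (Suc n))" for n i g
    using partial_products_face[OF in_E[OF that(2)]] by (simp add: Ecom_def AfCom_def)
  have f_degen: "partial_products (Suc n) (degen (Ecom G T) n i g)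
      = degen (AfCom G T) n i (partial_products n g)"
    if "i \<le> n" "g \<in> topspace (level (Ecom G T) n)" for n i g
    using partial_products_degen[OF in_E[OF that(2)] that(1)] by (simp add: Ecom_def AfCom_def)
  have face_in: "face (Ecom G T) n i g \<in> topspace (level (Ecom G T) n)"
    if "i \<le> Suc n" and g: "g \<in> topspace (level (Ecom G T) (Suc n))" for n i g
  proof -
    have "face (Ecom G T) n i g \<in> {..n} \<rightarrow>\<^sub>E carrier G"
      using in_E[OF g] that(1) by (auto simp: Ecom_def Ecom_face_def PiE_iff)
    moreover have "partial_products n (face (Ecom G T) n i g) \<in> topspace (level (AfCom G T) n)"
      unfolding f_face[OF that]
      using AfCom.continuous_face[OF that(1)] E_iff[OF in_E[OF g]] g
      by (auto simp: continuous_map_def Pi_def)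
    ultimately show ?thesis using E_iff by blast
  qed
  have degen_in: "degen (Ecom G T) n i g \<in> topspace (level (Ecom G T) (Suc n))"
    if "i \<le> n" and g: "g \<in> topspace (level (Ecom G T) n)" for n i g
  proof -
    have "degen (Ecom G T) n i g \<in> {..Suc n} \<rightarrow>\<^sub>E carrier G"
      using in_E[OF g] that(1) by (auto simp: Ecom_def Ecom_degen_def PiE_iff)
    moreover have "partial_products (Suc n) (degen (Ecom G T) n i g)
        \<in> topspace (level (AfCom G T) (Suc n))"
      unfolding f_degen[OF that]
      using AfCom.continuous_degen[OF that(1)] E_iff[OF in_E[OF g]] g
      by (auto simp: continuous_map_def Pi_def)
    ultimately show ?thesis using E_iff by blast
  qed
  have "simplicial_space (Ecom G T)"
    using simplicial_space_AfCom maps face_in degen_in f_face f_degen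
    by (rule simplicial_space_transport[where f = partial_products and g = consecutive_quotients])
  moreover have "simplicial_isomorphism (Ecom G T) (AfCom G T) partial_products"
    using maps f_face f_degen by (auto simp: simplicial_isomorphism_def homeomorphic_map_maps)
  ultimately show ?thesis
    using simplicial_space_AfCom by (auto simp: isomorphic_simplicial_spaces_def)
qed

end

theorem proposition14:
  fixes G :: "('a, 'b) monoid_scheme" and T :: "'a topology"
  assumes "topological_group G T"
  shows "isomorphic_simplicial_spaces (Ecom G T) (AfCom G T) \<and>
         geometric_realization (Ecom G T) homeomorphic_space geometric_realization (AfCom G T)"
  using topological_group.isomorphic_Ecom_AfCom[OF assms] homeomorphic_realizations by blast

end
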